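(* Let $\mathsf{P}$ be the Promislow group. Every trivial-unit statement for $\mathbb{Z}[\mathsf{P}]$ is equivalent to the conjunction of the following two statements. (I) Every unit $u$ with $\bar u$ trivial in $\mathbb{F}_2[\mathsf{P}]$ is trivial; equivalently, writing $g^{-1}u=1+2w$, where $g\in\mathsf{P}$ is the element with $\bar u=\bar g$ and $w\in\mathbb{Z}[\mathsf{P}]$, one has $w=0$. (II) No unit of $\mathbb{Z}[\mathsf{P}]$ reduces modulo $2$ to a nontrivial unit of $\mathbb{F}_2[\mathsf{P}]$.
   Context: The Promislow (Hantzsche--Wendt) group is $\mathsf{P}=\langle a,b\mid b^{-1}a^2b=a^{-2},\ a^{-1}b^2a=b^{-2}\rangle$; it is torsion-free. For $K$ a field or $K=\mathbb{Z}$, a unit of the group ring $K[\mathsf{P}]$ is called trivial if it equals $\kappa g$ with $\kappa$ a unit of $K$ and $g\in\mathsf{P}$, and nontrivial otherwise. A trivial-unit statement for $\mathbb{Z}[\mathsf{P}]$ is an assertion that the units of $\mathbb{Z}[\mathsf{P}]$ under consideration are trivial: for example all units (Higman's conjecture for $\mathsf{P}$), or all units whose support lies in a given ball of the word metric for $\{a,b\}$; the units in (I) and (II) are the units under consideration. For $u\in\mathbb{Z}[\mathsf{P}]$, $\bar u\in\mathbb{F}_2[\mathsf{P}]$ denotes the reduction of the coefficients of $u$ modulo $2$, and for $g\in\mathsf{P}$, $\bar g$ denotes $g$ viewed in $\mathbb{F}_2[\mathsf{P}]$. Let $\varepsilon\colon\mathbb{Z}[\mathsf{P}]\to\mathbb{Z}$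 be the augmentation (sum of coefficients). For a unit $u$ of $\mathbb{Z}[\mathsf{P}]$ one has $\varepsilon(u)=\pm1$; throughout, units $u$ of $\mathbb{Z}[\mathsf{P}]$ are normalized, replacing $u$ by $-u$ if necessary, so that $\varepsilon(u)=1$. *)

theory Defs
  imports "HOL-Library.Poly_Mapping" "HOL-Library.Z2"
begin

section \<open>The Promislow group\<close>

datatype gen = A | B

text \<open>A letter \<open>(x, False)\<close> stands for the generator \<open>x\<close>, and \<open>(x, True)\<close> for its inverse.\<close>

type_synonym word = "(gen \<times> bool) list"

text \<open>
  The congruence on words whose quotient is
  \<open>\<langle>a, b | b\<^sup>-\<^sup>1 a\<^sup>2 b = a\<^sup>-\<^sup>2, a\<^sup>-\<^sup>1 b\<^sup>2 a = b\<^sup>-\<^sup>2\<rangle>\<close>.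
\<close>

inductive weq :: "word \<Rightarrow> word \<Rightarrow> bool" where
  refl: "weq u u"
| sym: "weq u v \<Longrightarrow> weq v u"
| trans: "weq u v \<Longrightarrow> weq v w \<Longrightarrow> weq u w"
| append: "weq u u' \<Longrightarrow> weq v v' \<Longrightarrow> weq (u @ v) (u' @ v')"
| cancel: "weq [(x, s), (x, \<not> s)] []"
| rel_a: "weq [(B, True), (A, False), (A, False), (B, False)] [(A, True), (A, True)]"
| rel_b: "weq [(A, True), (B, False), (B, False), (A, False)] [(B, True), (B, True)]"

definition winv :: "word \<Rightarrow> word" where
  "winv w = rev (map (\<lambda>(x, s). (x, \<not> s)) w)"

lemma winv_simps:
  "winv [] = []"
  "winv ((x, s) # w) = winv w @ [(x, \<not> s)]"
  "winv (u @ v) = winv v @ winv u"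
  "winv (winv w) = w"
  by (auto simp: winv_def rev_map o_def case_prod_unfold)

lemma winv_left: "weq (winv w @ w) []"
proof (induction w)
  case Nil
  show ?case by (simp add: winv_simps weq.refl)
next
  case (Cons p w)
  obtain x s where p: "p = (x, s)" by (cases p)
  have "weq [(x, \<not> s), (x, \<not> \<not> s)] []" by (rule weq.cancel)
  then have "weq ([(x, \<not> s), (x, s)] @ w) ([] @ w)"
    by (intro weq.append[OF _ weq.refl]) simp
  then have "weq (winv w @ ([(x, \<not> s), (x, s)] @ w)) (winv w @ ([] @ w))"
    by (rule weq.append[OF weq.refl])
  then have "weq (winv (p # w) @ (p # w)) (winv w @ w)"
    by (simp add: p winv_simps)
  then show ?case using Cons.IH by (rule weq.trans)
qed

lemma winv_right: "weq (w @ winv w) []"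
  using winv_left[of "winv w"] by (simp add: winv_simps)

lemma winv_cong:
  assumes "weq u v"
  shows "weq (winv u) (winv v)"
proof -
  have "weq (winv u @ (v @ winv v)) (winv u @ [])"
    by (intro weq.append weq.refl winv_right)
  moreover have "weq ((winv u @ u) @ winv v) ((winv u @ v) @ winv v)"
    by (intro weq.append weq.refl assms)
  moreover have "weq ((winv u @ u) @ winv v) ([] @ winv v)"
    by (intro weq.append weq.refl winv_left)
  ultimately show ?thesis
    by (metis append.assoc append_Nil append_Nil2 weq.sym weq.trans)
qed

quotient_type promislow = word / weq
  by (intro equivpI reflpI sympI transpI) (blast intro: weq.refl weq.sym weq.trans)+

text \<open>
  The group is written additively, although it is not commutative, because the convolution
  product on \<open>poly_mapping\<close> is defined over an additive monoid of exponents. Thus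
  \<open>g + h\<close> is the group product, \<open>- g\<close> the inverse and \<open>0\<close> the identity of the group.
\<close>

instantiation promislow :: group_add
begin

lift_definition zero_promislow :: promislow is "[]" .

lift_definition plus_promislow :: "promislow \<Rightarrow> promislow \<Rightarrow> promislow" is "(@)"
  by (rule weq.append)

lift_definition uminus_promislow :: "promislow \<Rightarrow> promislow" is winv
  by (rule winv_cong)

definition minus_promislow :: "promislow \<Rightarrow> promislow \<Rightarrow> promislow" where
  "minus_promislow g h = g + - h"

instance
proof
  fix g h k :: promislow
  show "g + h + k = g + (h + k)" by transfer (simp add: weq.refl)
  show "0 + g = g" by transfer (simp add: weq.refl)
  show "g + 0 = g" by transfer (simp add: weq.refl)
  show "- g + g = 0" by transfer (rule winv_left)
  show "g + - h = g - h" by (simp add: minus_promislow_def)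
qed

end

section \<open>Group rings\<close>

text \<open>
  The group ring \<open>K[P]\<close> is \<open>promislow \<Rightarrow>\<^sub>0 'k\<close>, the finitely supported functions with
  convolution; the element \<open>\<kappa> g\<close> is \<open>Poly_Mapping.single g \<kappa>\<close>. The field with two
  elements is the type \<open>bit\<close>.
\<close>

definition ring_unit :: "'r::ring_1 \<Rightarrow> bool" where
  "ring_unit u \<longleftrightarrow> (\<exists>v. u * v = 1 \<and> v * u = 1)"

definition trivial_unit :: "(promislow \<Rightarrow>\<^sub>0 'k::comm_ring_1) \<Rightarrow> bool" where
  "trivial_unit u \<longleftrightarrow> (\<exists>\<kappa> g. ring_unit \<kappa> \<and> u = Poly_Mapping.single g \<kappa>)"

definition nontrivial_unit :: "(promislow \<Rightarrow>\<^sub>0 'k::comm_ring_1) \<Rightarrow> bool" where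
  "nontrivial_unit u \<longleftrightarrow> ring_unit u \<and> \<not> trivial_unit u"

definition reduce_mod2 :: "(promislow \<Rightarrow>\<^sub>0 int) \<Rightarrow> (promislow \<Rightarrow>\<^sub>0 bit)" where
  "reduce_mod2 u = Poly_Mapping.map of_int u"

definition augmentation :: "(promislow \<Rightarrow>\<^sub>0 int) \<Rightarrow> int" where
  "augmentation u = (\<Sum>g\<in>Poly_Mapping.keys u. Poly_Mapping.lookup u g)"

section \<open>Trivial-unit statements\<close>

text \<open>
  A trivial-unit statement is given by the set \<open>S\<close> of units under consideration, for example
  all units, or all units supported in a given ball of the word metric.
\<close>

definition trivial_unit_statement :: "(promislow \<Rightarrow>\<^sub>0 int) set \<Rightarrow> bool" where
  "trivial_unit_statement S \<longleftrightarrow> (\<forall>u\<in>S. trivial_unit u)"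

text \<open>
  The units under consideration after replacing \<open>u\<close> by \<open>- u\<close> where necessary, so that
  the augmentation is \<open>1\<close>.
\<close>

definition normalized :: "(promislow \<Rightarrow>\<^sub>0 int) set \<Rightarrow> (promislow \<Rightarrow>\<^sub>0 int) set" where
  "normalized S = {u. augmentation u = 1 \<and> (u \<in> S \<or> - u \<in> S)}"

definition statement_I :: "(promislow \<Rightarrow>\<^sub>0 int) set \<Rightarrow> bool" where
  "statement_I S \<longleftrightarrow>
    (\<forall>u\<in>normalized S. trivial_unit (reduce_mod2 u) \<longrightarrow> trivial_unit u)"

definition statement_I' :: "(promislow \<Rightarrow>\<^sub>0 int) set \<Rightarrow> bool" where
  "statement_I' S \<longleftrightarrow>
    (\<forall>u\<in>normalized S. \<forall>g w.
      reduce_mod2 u = Poly_Mapping.single g 1 \<and> Poly_Mapping.single (- g) 1 * u = 1 + 2 * w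
      \<longrightarrow> w = 0)"

definition statement_II :: "(promislow \<Rightarrow>\<^sub>0 int) set \<Rightarrow> bool" where
  "statement_II S \<longleftrightarrow> (\<forall>u\<in>normalized S. \<not> nontrivial_unit (reduce_mod2 u))"

end

theory Submission
  imports Defs
begin

text \<open>
  Augmentation and reduction modulo 2 are ring homomorphisms out of \<open>\<int>[P]\<close>. Hence a unit has
  augmentation \<open>\<plusminus> 1\<close>, so every unit or its negative is normalized, and its reduction
  modulo 2 is again a unit. A trivial unit of \<open>\<int>[P]\<close> is \<open>\<plusminus> g\<close>, which reduces to the trivial
  unit \<open>g\<close>. So triviality of all units of a set splits into two parts: their reductions are
  trivial (II), and units with trivial reduction are trivial (I).

  If \<open>u\<close> reduces to \<open>g\<close>, then all coefficients of \<open>u - g\<close> are even, so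
  \<open>g\<^sup>-\<^sup>1 u = 1 + 2 w\<close>, where \<open>w\<close> is unique because \<open>\<int>[P]\<close> has no 2-torsion. Here \<open>w = 0\<close>
  means \<open>u = g\<close>. Conversely, a trivial \<open>u\<close> of augmentation 1 is a group element \<open>h\<close>, and
  comparing reductions gives \<open>h = g\<close>, that is, \<open>w = 0\<close>. None of this depends on the relations
  of the group.
\<close>

section \<open>Additive maps on monoid rings\<close>

lemma poly_mapping_single_induct [case_names zero add]:
  fixes p :: "'a \<Rightarrow>\<^sub>0 'b::comm_monoid_add"
  assumes "P 0" and "\<And>p k c. P p \<Longrightarrow> P (p + Poly_Mapping.single k c)"
  shows "P p"
proof (induction p rule: update_induct)
  case const
  show ?case by (fact assms(1))
next
  case (update p k c)
  have "Poly_Mapping.update k c p = p + Poly_Mapping.single k c"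
    using update(1)
    by (intro poly_mapping_eqI) (auto simp: lookup_update lookup_add lookup_single in_keys_iff)
  with assms(2)[OF update(3)] show ?case by simp
qed

text \<open>
  Both sides are biadditive in \<open>p\<close> and \<open>q\<close>, so multiplicativity need only be checked on
  monomials.
\<close>

lemma additive_multiplicative_on_singles:
  fixes f :: "('a::monoid_add \<Rightarrow>\<^sub>0 'b::semiring_0) \<Rightarrow> 'c::semiring_0"
  assumes zero: "f 0 = 0"
    and add: "\<And>p q. f (p + q) = f p + f q"
    and single: "\<And>g h c d. f (Poly_Mapping.single g c * Poly_Mapping.single h d) =
      f (Poly_Mapping.single g c) * f (Poly_Mapping.single h d)"
  shows "f (p * q) = f p * f q"
proof (induction p rule: poly_mapping_single_induct)
  case zero
  show ?case by (simp add: assms(1))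
next
  case (add p g c)
  have "f (Poly_Mapping.single g c * q) = f (Poly_Mapping.single g c) * f q"
    by (induction q rule: poly_mapping_single_induct)
      (simp_all add: assms distrib_left)
  with add show ?case by (simp add: assms(2) distrib_right)
qed

section \<open>Augmentation\<close>

lemma augmentation_superset:
  assumes "finite X" "Poly_Mapping.keys u \<subseteq> X"
  shows "augmentation u = (\<Sum>g\<in>X. Poly_Mapping.lookup u g)"
  unfolding augmentation_def using assms
  by (intro sum.mono_neutral_left) (auto simp: in_keys_iff)

lemma augmentation_zero [simp]: "augmentation 0 = 0"
  by (simp add: augmentation_def)

lemma augmentation_single [simp]: "augmentation (Poly_Mapping.single g c) = c"
  by (simp add: augmentation_def)

lemma augmentation_add: "augmentation (u + v) = augmentation u + augmentation v"
proof -
  let ?X = "Poly_Mapping.keys u \<union> Poly_Mapping.keys v"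
  have "Poly_Mapping.keys (u + v) \<subseteq> ?X" by (rule Poly_Mapping.keys_add)
  then show ?thesis
    by (simp add: augmentation_superset[of ?X] lookup_add sum.distrib)
qed

lemma augmentation_uminus: "augmentation (- u) = - augmentation u"
  using augmentation_add[of u "- u"] by simp

lemma augmentation_mult: "augmentation (u * v) = augmentation u * augmentation v"
  by (rule additive_multiplicative_on_singles) (simp_all add: augmentation_add mult_single)

lemma augmentation_unit:
  assumes "ring_unit u"
  shows "augmentation u = 1 \<or> augmentation u = - 1"
proof -
  obtain v where "u * v = 1" using assms by (auto simp: ring_unit_def)
  then have "augmentation u * augmentation v = 1"
    by (metis augmentation_mult augmentation_single single_one)
  then show ?thesis by (auto simp: zmult_eq_1_iff)
qed

section \<open>Reduction modulo 2\<close>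

lemma lookup_reduce_mod2 [simp]:
  "Poly_Mapping.lookup (reduce_mod2 u) g = of_int (Poly_Mapping.lookup u g)"
  by (simp add: reduce_mod2_def map.rep_eq when_def)

lemma reduce_mod2_single [simp]:
  "reduce_mod2 (Poly_Mapping.single g c) = Poly_Mapping.single g (of_int c)"
  by (simp add: reduce_mod2_def)

lemma reduce_mod2_mult: "reduce_mod2 (u * v) = reduce_mod2 u * reduce_mod2 v"
proof (rule additive_multiplicative_on_singles)
  show "reduce_mod2 0 = 0"
    by (rule poly_mapping_eqI) simp
  show "reduce_mod2 (p + q) = reduce_mod2 p + reduce_mod2 q" for p q
    by (rule poly_mapping_eqI) (simp only: lookup_reduce_mod2 lookup_add of_int_add)
qed (simp only: mult_single reduce_mod2_single of_int_mult)

lemma reduce_mod2_unit: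
  assumes "ring_unit u"
  shows "ring_unit (reduce_mod2 u)"
proof -
  have "reduce_mod2 1 = 1"
    using reduce_mod2_single[of 0 1] by simp
  then show ?thesis
    using assms unfolding ring_unit_def by (metis reduce_mod2_mult)
qed

lemma of_int_bit_eq_0_iff: "(of_int k :: bit) = 0 \<longleftrightarrow> even k"
proof (cases "even k")
  case True
  then show ?thesis by (auto elim!: evenE)
next
  case False
  then show ?thesis by (auto elim!: oddE simp del: add_bit_eq_xor)
qed

lemma reduce_mod2_eq_imp_diff_even:
  assumes "reduce_mod2 u = reduce_mod2 v"
  obtains w where "u = v + 2 * w"
proof
  define w where "w = Poly_Mapping.map (\<lambda>k. k div 2) (u - v)"
  show "u = v + 2 * w"
  proof (rule poly_mapping_eqI)
    fix g
    have "(of_int (Poly_Mapping.lookup (u - v) g) :: bit) = 0"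
      using arg_cong[OF assms, of "\<lambda>p. Poly_Mapping.lookup p g"]
      by (simp add: lookup_minus)
    then have "even (Poly_Mapping.lookup (u - v) g)"
      by (simp only: of_int_bit_eq_0_iff)
    then have "2 * Poly_Mapping.lookup w g = Poly_Mapping.lookup (u - v) g"
      by (simp add: w_def map.rep_eq when_def)
    moreover have "Poly_Mapping.lookup (v + 2 * w) g =
        Poly_Mapping.lookup v g + 2 * Poly_Mapping.lookup w g"
      by (simp only: mult_2 lookup_add)
    ultimately show "Poly_Mapping.lookup u g = Poly_Mapping.lookup (v + 2 * w) g"
      by (simp add: lookup_minus)
  qed
qed

lemma double_eq_0_iff:
  fixes w :: "'a::monoid_add \<Rightarrow>\<^sub>0 int"
  shows "2 * w = 0 \<longleftrightarrow> w = 0"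
proof
  assume "2 * w = 0"
  show "w = 0"
  proof (rule poly_mapping_eqI)
    fix g
    have "Poly_Mapping.lookup (w + w) g = 0"
      using \<open>2 * w = 0\<close> by (simp only: mult_2 lookup_zero)
    then show "Poly_Mapping.lookup w g = Poly_Mapping.lookup 0 g"
      by (simp add: lookup_add)
  qed
qed simp

section \<open>Trivial units\<close>

lemma trivial_unit_uminus:
  assumes "trivial_unit u"
  shows "trivial_unit (- u)"
proof -
  obtain c g where c: "ring_unit c" "u = Poly_Mapping.single g c"
    using assms by (auto simp: trivial_unit_def)
  have "ring_unit (- c)"
    using c(1) unfolding ring_unit_def by (metis minus_mult_minus)
  with c(2) show ?thesis
    unfolding trivial_unit_def by (metis single_uminus)
qed

text \<open>Over the field with two elements the only scalar unit is 1.\<close>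

lemma trivial_unit_bit_iff:
  "trivial_unit (u :: promislow \<Rightarrow>\<^sub>0 bit) \<longleftrightarrow> (\<exists>g. u = Poly_Mapping.single g 1)"
proof -
  have "ring_unit c \<longleftrightarrow> c = 1" for c :: bit
    by (cases c) (auto simp: ring_unit_def)
  then show ?thesis by (simp add: trivial_unit_def)
qed

lemma trivial_unit_single_1: "trivial_unit (Poly_Mapping.single g 1)"
  unfolding trivial_unit_def ring_unit_def by (metis mult_1)

lemma single_1_cancel:
  "Poly_Mapping.single (- g) 1 * u = Poly_Mapping.single (- g) 1 * v \<longleftrightarrow> u = v"
  for u v :: "'a::group_add \<Rightarrow>\<^sub>0 'b::ring_1"
proof
  assume "Poly_Mapping.single (- g) 1 * u = Poly_Mapping.single (- g) 1 * v"
  then have "Poly_Mapping.single g 1 * (Poly_Mapping.single (- g) 1 * u) =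
      Poly_Mapping.single g 1 * (Poly_Mapping.single (- g) 1 * v)"
    by simp
  then show "u = v" by (simp add: mult_single flip: mult.assoc)
qed simp

lemma single_inverse_mult_eq_1_iff:
  "Poly_Mapping.single (- g) 1 * u = 1 \<longleftrightarrow> u = Poly_Mapping.single g 1"
  for u :: "'a::group_add \<Rightarrow>\<^sub>0 'b::ring_1"
  using single_1_cancel[of g u "Poly_Mapping.single g 1"] by (simp add: mult_single)

lemma trivial_unit_of_augmentation_1:
  assumes "trivial_unit u" "augmentation u = 1"
  obtains g where "u = Poly_Mapping.single g 1"
  using assms by (auto simp: trivial_unit_def)

lemma ex1_doubled_remainder:
  assumes "reduce_mod2 u = Poly_Mapping.single g 1"
  shows "\<exists>!w. Poly_Mapping.single (- g) 1 * u = 1 + 2 * w"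
proof -
  have "reduce_mod2 u = reduce_mod2 (Poly_Mapping.single g 1)"
    using assms by simp
  then obtain v where v: "u = Poly_Mapping.single g 1 + 2 * v"
    by (rule reduce_mod2_eq_imp_diff_even)
  show ?thesis
  proof (rule ex1I)
    show "Poly_Mapping.single (- g) 1 * u = 1 + 2 * (Poly_Mapping.single (- g) 1 * v)"
      by (simp add: v distrib_left mult_single mult_2)
    fix w
    assume "Poly_Mapping.single (- g) 1 * u = 1 + 2 * w"
    then have "2 * (w - Poly_Mapping.single (- g) 1 * v) = 0"
      by (simp add: v mult_single mult_2 algebra_simps)
    then show "w = Poly_Mapping.single (- g) 1 * v"
      by (simp only: double_eq_0_iff right_minus_eq)
  qed
qed

section \<open>The two statements\<close>

lemma trivial_unit_statement_iff:
  assumes units: "\<forall>u\<in>S. ring_unit u"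
  shows "trivial_unit_statement S \<longleftrightarrow> statement_I S \<and> statement_II S"
proof
  assume *: "trivial_unit_statement S"
  have triv: "trivial_unit u" if "u \<in> normalized S" for u
    using that * trivial_unit_uminus[of "- u"]
    by (auto simp: normalized_def trivial_unit_statement_def)
  have "trivial_unit (reduce_mod2 u)" if "u \<in> normalized S" for u
  proof -
    have "augmentation u = 1" using that by (simp add: normalized_def)
    with triv[OF that] obtain g where "u = Poly_Mapping.single g 1"
      by (rule trivial_unit_of_augmentation_1)
    then show ?thesis by (simp add: trivial_unit_single_1)
  qed
  with triv show "statement_I S \<and> statement_II S"
    by (simp add: statement_I_def statement_II_def nontrivial_unit_def)
next
  assume *: "statement_I S \<and> statement_II S"
  have triv: "trivial_unit u" if "u \<in> normalized S" "ring_unit u" for u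
    using that * reduce_mod2_unit[of u]
    by (auto simp: statement_I_def statement_II_def nontrivial_unit_def)
  show "trivial_unit_statement S"
    unfolding trivial_unit_statement_def
  proof
    fix u
    assume u: "u \<in> S"
    then have unit: "ring_unit u" using units by blast
    from augmentation_unit[OF unit] show "trivial_unit u"
    proof
      assume "augmentation u = 1"
      then show ?thesis using u unit triv by (simp add: normalized_def)
    next
      assume "augmentation u = - 1"
      then have "- u \<in> normalized S"
        using u by (simp add: normalized_def augmentation_uminus)
      moreover have "ring_unit (- u)"
        using unit unfolding ring_unit_def by (metis minus_mult_minus)
      ultimately show ?thesis using triv trivial_unit_uminus[of "- u"] by simp
    qed
  qed
qed

lemma statement_I_iff: "statement_I S \<longleftrightarrow> statement_I' S"
proof
  assume I: "statement_I S"
  show "statement_I' S"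
    unfolding statement_I'_def
  proof (intro ballI allI impI, elim conjE)
    fix u g w
    assume u: "u \<in> normalized S"
      and red: "reduce_mod2 u = Poly_Mapping.single g 1"
      and w: "Poly_Mapping.single (- g) 1 * u = 1 + 2 * w"
    have "trivial_unit (reduce_mod2 u)" by (simp add: red trivial_unit_single_1)
    with I u have "trivial_unit u" by (simp add: statement_I_def)
    moreover have "augmentation u = 1" using u by (simp add: normalized_def)
    ultimately obtain h where h: "u = Poly_Mapping.single h 1"
      by (rule trivial_unit_of_augmentation_1)
    with red have "(Poly_Mapping.single h 1 :: promislow \<Rightarrow>\<^sub>0 bit) = Poly_Mapping.single g 1"
      by simp
    then have "h = g" by (metis lookup_single_eq lookup_single_not_eq zero_neq_one)
    with h have "Poly_Mapping.single (- g) 1 * u = 1"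
      by (simp only: single_inverse_mult_eq_1_iff)
    with w have "2 * w = 0" by simp
    then show "w = 0" by (simp only: double_eq_0_iff)
  qed
next
  assume I': "statement_I' S"
  show "statement_I S"
    unfolding statement_I_def
  proof (intro ballI impI)
    fix u
    assume u: "u \<in> normalized S" and "trivial_unit (reduce_mod2 u)"
    then obtain g where red: "reduce_mod2 u = Poly_Mapping.single g 1"
      by (auto simp: trivial_unit_bit_iff)
    then obtain w where w: "Poly_Mapping.single (- g) 1 * u = 1 + 2 * w"
      using ex1_doubled_remainder by blast
    have "w = 0" using I' u red w unfolding statement_I'_def by blast
    with w have "u = Poly_Mapping.single g 1"
      by (simp flip: single_inverse_mult_eq_1_iff)
    then show "trivial_unit u" by (simp add: trivial_unit_single_1)
  qed
qed

theorem proposition3p1: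
  fixes S :: "(promislow \<Rightarrow>\<^sub>0 int) set"
  assumes "\<forall>u\<in>S. ring_unit u"
  shows "(trivial_unit_statement S \<longleftrightarrow> statement_I S \<and> statement_II S) \<and>
    (statement_I S \<longleftrightarrow> statement_I' S) \<and>
    (\<forall>u\<in>normalized S. trivial_unit (reduce_mod2 u) \<longrightarrow>
      (\<exists>!g. reduce_mod2 u = Poly_Mapping.single g 1)) \<and>
    (\<forall>u\<in>normalized S. \<forall>g. reduce_mod2 u = Poly_Mapping.single g 1 \<longrightarrow>
      (\<exists>!w. Poly_Mapping.single (- g) 1 * u = 1 + 2 * w))"
proof (intro conjI ballI allI impI)
  show "trivial_unit_statement S \<longleftrightarrow> statement_I S \<and> statement_II S"
    by (rule trivial_unit_statement_iff[OF assms])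
  show "statement_I S \<longleftrightarrow> statement_I' S"
    by (rule statement_I_iff)
next
  fix u
  assume "trivial_unit (reduce_mod2 u)"
  then obtain g where g: "reduce_mod2 u = Poly_Mapping.single g 1"
    by (auto simp: trivial_unit_bit_iff)
  show "\<exists>!g. reduce_mod2 u = Poly_Mapping.single g 1"
    using g by (metis lookup_single_eq lookup_single_not_eq zero_neq_one)
next
  fix u g
  assume "reduce_mod2 u = Poly_Mapping.single g 1"
  then show "\<exists>!w. Poly_Mapping.single (- g) 1 * u = 1 + 2 * w"
    by (rule ex1_doubled_remainder)
qed

end
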